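(* The calculus PC is complete with respect to $\vDash_{PC}$: every formula of $\mathcal{L}_{PC}$ that is true at every world of every conditional neighbourhood model under $\vDash_{PC}$ is derivable in PC.
   Context: Fix a set $P$ of proposition letters and a finite set $Ag$ of agents. The language $\mathcal{L}_{PC}$ is $\phi::=\top\mid p\mid\neg\phi\mid(\phi\wedge\phi)\mid B_a(\phi,\phi)\mid[\phi]\phi$ ($p\in P$, $a\in Ag$); $\bot,\vee,\to,\leftrightarrow$ as usual, $K_a\phi:=\neg B_a(\neg\phi,\top)$, $\check K_a\phi:=\neg K_a\neg\phi$. A conditional neighbourhood model is $\mathfrak{M}=(W,N,V)$: $W$ non-empty, $V:P\to\mathcal{P}(W)$, and $N$ assigns to each $a\in Ag$, $w\in W$, $X\subseteq W$ a set $N_a^w(X)\subseteq\mathcal{P}(W)$ such that, writing $[w]_a=\{v\mid\forall X\subseteq W,\ N_a^w(X)=N_a^v(X)\}$: (c) each $Y\in N_a^w(X)$ has $Y\subseteq X\cap[w]_a$; (ec) if $X\cap[w]_a=Y\cap[w]_a$ then $N_a^w(X)=N_a^w(Y)$; (d) for $Y\in N_a^w(X)$, $(X\cap[w]_a)\setminus Y\notin N_a^w(X)$; (sc) for $Y,Z\subseteq X\cap[w]_a$, if $(X\cap[w]_a)\setminus Y\notin N_a^w(X)$ and $Y\subsetneq Z$ then $Z\in N_a^w(X)$. Semantics $\vDash_{PC}$: $\top$ always true; $p$ iff $w\in V(p)$; Booleans as usual; $\mathfrak{M},w\vDash B_a(\phi,\psi)$ iff some $Y\in N_a^w(\llbracket\phi\rrbracket_{\mathfrak{M}})$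 has $Y\subseteq\llbracket\psi\rrbracket_{\mathfrak{M}}$ (where $\llbracket\phi\rrbracket_{\mathfrak{M}}=\{v\mid\mathfrak{M},v\vDash\phi\}$); $\mathfrak{M},w\vDash[\phi]\psi$ iff ($\mathfrak{M},w\vDash\phi$ implies $\mathfrak{M}^\phi,w\vDash\psi$). Here the update $\mathfrak{M}^\phi=(W^\phi,{}^\phi N,V^\phi)$ has $W^\phi=\llbracket\phi\rrbracket_{\mathfrak{M}}$, ${}^\phi N_a^w(X)=N_a^w(X)$ for $w\in W^\phi$ and $X\subseteq W^\phi$, and $V^\phi(p)=V(p)\cap W^\phi$ (its induced indistinguishability classes are $[w]_a\cap W^\phi$). The calculus PC consists of the CN calculus over $\mathcal{L}_{PC}$ — axioms (Taut) propositional tautologies; (Dist-K) $K_a(\phi\to\psi)\to K_a\phi\to K_a\psi$; (T) $K_a\phi\to\phi$; (5B) $B_a(\phi,\psi)\to K_aB_a(\phi,\psi)$; (4B) $\neg B_a(\phi,\psi)\to K_a\neg B_a(\phi,\psi)$; (D) $B_a(\phi,\psi)\to\neg B_a(\phi,\neg\psi)$; (EC) $K_a(\phi\leftrightarrow\psi)\to B_a(\phi,\chi)\to B_a(\psi,\chi)$; (M) $K_a(\phi\to\psi)\to B_a(\chi,\phi)\to B_a(\chi,\psi)$; (C) $B_a(\phi,\psi)\to B_a(\phi,\phi\wedge\psi)$; (SC) $\neg B_a(\chi,\neg\phi)\wedge\check K_a(\chi\wedge\neg\phi\wedge\psi)\to B_a(\chi,\phi\vee\psi)$; rules Modus Ponens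 and from $\phi$ infer $K_a\phi$ — plus the usual reduction axioms for public announcement: $[\phi]\top\leftrightarrow\top$, $[\phi]p\leftrightarrow(\phi\to p)$, $[\phi]\neg\psi\leftrightarrow(\phi\to\neg[\phi]\psi)$, $[\phi](\psi\wedge\chi)\leftrightarrow([\phi]\psi\wedge[\phi]\chi)$, and $[\phi]B_a(\psi,\chi)\leftrightarrow(\phi\to B_a(\phi\wedge[\phi]\psi,[\phi]\chi))$.
   Formalization: PC is taken with one further rule, from ψ↔χ infer [φ]ψ↔[φ]χ; with only the listed axioms and rules the claim fails, since [p][p]⊤ is valid but not derivable. *)

theory Defs
  imports Main
begin

section \<open>Language\<close>

datatype ('p, 'a) fm =
    Truth ("\<^bold>\<top>")
  | Prop 'p
  | Neg "('p, 'a) fm" ("\<^bold>\<not> _" [70] 70)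
  | Conj "('p, 'a) fm" "('p, 'a) fm" (infixr "\<^bold>\<and>" 65)
  | Bel 'a "('p, 'a) fm" "('p, 'a) fm"
  | Ann "('p, 'a) fm" "('p, 'a) fm" ("\<^bold>[_\<^bold>] _" [0, 70] 70)

abbreviation Disj (infixr "\<^bold>\<or>" 60) where
  "\<phi> \<^bold>\<or> \<psi> \<equiv> \<^bold>\<not> (\<^bold>\<not> \<phi> \<^bold>\<and> \<^bold>\<not> \<psi>)"

abbreviation Impl (infixr "\<^bold>\<longrightarrow>" 55) where
  "\<phi> \<^bold>\<longrightarrow> \<psi> \<equiv> \<^bold>\<not> (\<phi> \<^bold>\<and> \<^bold>\<not> \<psi>)"

abbreviation Equiv (infix "\<^bold>\<longleftrightarrow>" 50) where
  "\<phi> \<^bold>\<longleftrightarrow> \<psi> \<equiv> (\<phi> \<^bold>\<longrightarrow> \<psi>) \<^bold>\<and> (\<psi> \<^bold>\<longrightarrow> \<phi>)"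

abbreviation Know :: "'a \<Rightarrow> ('p, 'a) fm \<Rightarrow> ('p, 'a) fm" where
  "Know a \<phi> \<equiv> \<^bold>\<not> Bel a (\<^bold>\<not> \<phi>) \<^bold>\<top>"

abbreviation Poss :: "'a \<Rightarrow> ('p, 'a) fm \<Rightarrow> ('p, 'a) fm" where
  "Poss a \<phi> \<equiv> \<^bold>\<not> Know a (\<^bold>\<not> \<phi>)"


section \<open>Conditional neighbourhood models\<close>

text \<open>
  The set of worlds is an explicit carrier, since announcements shrink it.
  Only the values \<open>nbh M a w X\<close> with \<open>w \<in> worlds M\<close> and \<open>X \<subseteq> worlds M\<close> are meaningful.
\<close>

record ('w, 'p, 'a) model =
  worlds :: "'w set"
  nbh :: "'a \<Rightarrow> 'w \<Rightarrow> 'w set \<Rightarrow> 'w set set"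
  val :: "'p \<Rightarrow> 'w set"

definition cell :: "('w, 'p, 'a) model \<Rightarrow> 'a \<Rightarrow> 'w \<Rightarrow> 'w set" where
  "cell M a w = {v \<in> worlds M. \<forall>X \<subseteq> worlds M. nbh M a w X = nbh M a v X}"

locale cond_nbh_model =
  fixes M :: "('w, 'p, 'a) model"
  assumes nonempty: "worlds M \<noteq> {}"
    and val: "val M p \<subseteq> worlds M"
    and nbh: "\<lbrakk>w \<in> worlds M; X \<subseteq> worlds M\<rbrakk> \<Longrightarrow> nbh M a w X \<subseteq> Pow (worlds M)"
    and c: "\<lbrakk>w \<in> worlds M; X \<subseteq> worlds M; Y \<in> nbh M a w X\<rbrakk> \<Longrightarrow> Y \<subseteq> X \<inter> cell M a w"
    and ec: "\<lbrakk>w \<in> worlds M; X \<subseteq> worlds M; Y \<subseteq> worlds M; X \<inter> cell M a w = Y \<inter> cell M a w\<rbrakk>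
      \<Longrightarrow> nbh M a w X = nbh M a w Y"
    and d: "\<lbrakk>w \<in> worlds M; X \<subseteq> worlds M; Y \<in> nbh M a w X\<rbrakk>
      \<Longrightarrow> (X \<inter> cell M a w) - Y \<notin> nbh M a w X"
    and sc: "\<lbrakk>w \<in> worlds M; X \<subseteq> worlds M; Y \<subseteq> X \<inter> cell M a w; Z \<subseteq> X \<inter> cell M a w;
        (X \<inter> cell M a w) - Y \<notin> nbh M a w X; Y \<subset> Z\<rbrakk>
      \<Longrightarrow> Z \<in> nbh M a w X"

definition restrict_model :: "('w, 'p, 'a) model \<Rightarrow> 'w set \<Rightarrow> ('w, 'p, 'a) model" where
  "restrict_model M S = \<lparr>worlds = S, nbh = nbh M, val = (\<lambda>p. val M p \<inter> S)\<rparr>"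


section \<open>Semantics\<close>

primrec sat :: "('w, 'p, 'a) model \<Rightarrow> 'w \<Rightarrow> ('p, 'a) fm \<Rightarrow> bool" ("_, _ \<Turnstile> _" [50, 50, 50] 50) where
  "M, w \<Turnstile> \<^bold>\<top> \<longleftrightarrow> True"
| "M, w \<Turnstile> Prop p \<longleftrightarrow> w \<in> val M p"
| "M, w \<Turnstile> \<^bold>\<not> \<phi> \<longleftrightarrow> \<not> (M, w \<Turnstile> \<phi>)"
| "M, w \<Turnstile> (\<phi> \<^bold>\<and> \<psi>) \<longleftrightarrow> (M, w \<Turnstile> \<phi>) \<and> (M, w \<Turnstile> \<psi>)"
| "M, w \<Turnstile> Bel a \<phi> \<psi> \<longleftrightarrow>
     (\<exists>Y \<in> nbh M a w {v \<in> worlds M. M, v \<Turnstile> \<phi>}. Y \<subseteq> {v \<in> worlds M. M, v \<Turnstile> \<psi>})"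
| "M, w \<Turnstile> \<^bold>[\<phi>\<^bold>] \<psi> \<longleftrightarrow>
     ((M, w \<Turnstile> \<phi>) \<longrightarrow> (restrict_model M {v \<in> worlds M. M, v \<Turnstile> \<phi>}, w \<Turnstile> \<psi>))"


section \<open>The calculus\<close>

primrec prop_eval :: "(('p, 'a) fm \<Rightarrow> bool) \<Rightarrow> ('p, 'a) fm \<Rightarrow> bool" where
  "prop_eval g \<^bold>\<top> \<longleftrightarrow> True"
| "prop_eval g (Prop p) \<longleftrightarrow> g (Prop p)"
| "prop_eval g (\<^bold>\<not> \<phi>) \<longleftrightarrow> \<not> prop_eval g \<phi>"
| "prop_eval g (\<phi> \<^bold>\<and> \<psi>) \<longleftrightarrow> prop_eval g \<phi> \<and> prop_eval g \<psi>"
| "prop_eval g (Bel a \<phi> \<psi>) \<longleftrightarrow> g (Bel a \<phi> \<psi>)"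
| "prop_eval g (\<^bold>[\<phi>\<^bold>] \<psi>) \<longleftrightarrow> g (\<^bold>[\<phi>\<^bold>] \<psi>)"

definition tautology :: "('p, 'a) fm \<Rightarrow> bool" where
  "tautology \<phi> \<longleftrightarrow> (\<forall>g. prop_eval g \<phi>)"

text \<open>
  There is no reduction axiom for \<open>\<^bold>[\<phi>\<^bold>] \<^bold>[\<psi>\<^bold>] \<chi>\<close>. Iterated announcements are reduced from the inside out,
  replacing provable equivalents in the scope of an announcement, which is what \<open>RE\<close> licenses.
  Without it \<open>\<^bold>[\<phi>\<^bold>] \<^bold>[\<psi>\<^bold>] \<^bold>\<top>\<close>, although valid, is not derivable: no other axiom or rule looks
  inside a formula of the form \<open>\<^bold>[\<phi>\<^bold>] \<^bold>[\<psi>\<^bold>] \<chi>\<close>. Replacement in all other positions is derivable.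
\<close>

inductive PC :: "('p, 'a) fm \<Rightarrow> bool" ("\<turnstile> _" [50] 50) where
  Taut: "tautology \<phi> \<Longrightarrow> \<turnstile> \<phi>"
| DistK: "\<turnstile> Know a (\<phi> \<^bold>\<longrightarrow> \<psi>) \<^bold>\<longrightarrow> Know a \<phi> \<^bold>\<longrightarrow> Know a \<psi>"
| T: "\<turnstile> Know a \<phi> \<^bold>\<longrightarrow> \<phi>"
| FiveB: "\<turnstile> Bel a \<phi> \<psi> \<^bold>\<longrightarrow> Know a (Bel a \<phi> \<psi>)"
| FourB: "\<turnstile> \<^bold>\<not> Bel a \<phi> \<psi> \<^bold>\<longrightarrow> Know a (\<^bold>\<not> Bel a \<phi> \<psi>)"
| D: "\<turnstile> Bel a \<phi> \<psi> \<^bold>\<longrightarrow> \<^bold>\<not> Bel a \<phi> (\<^bold>\<not> \<psi>)"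
| EC: "\<turnstile> Know a (\<phi> \<^bold>\<longleftrightarrow> \<psi>) \<^bold>\<longrightarrow> Bel a \<phi> \<chi> \<^bold>\<longrightarrow> Bel a \<psi> \<chi>"
| M: "\<turnstile> Know a (\<phi> \<^bold>\<longrightarrow> \<psi>) \<^bold>\<longrightarrow> Bel a \<chi> \<phi> \<^bold>\<longrightarrow> Bel a \<chi> \<psi>"
| C: "\<turnstile> Bel a \<phi> \<psi> \<^bold>\<longrightarrow> Bel a \<phi> (\<phi> \<^bold>\<and> \<psi>)"
| SC: "\<turnstile> \<^bold>\<not> Bel a \<chi> (\<^bold>\<not> \<phi>) \<^bold>\<and> Poss a (\<chi> \<^bold>\<and> \<^bold>\<not> \<phi> \<^bold>\<and> \<psi>) \<^bold>\<longrightarrow> Bel a \<chi> (\<phi> \<^bold>\<or> \<psi>)"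
| Ann_Truth: "\<turnstile> \<^bold>[\<phi>\<^bold>] \<^bold>\<top> \<^bold>\<longleftrightarrow> \<^bold>\<top>"
| Ann_Prop: "\<turnstile> \<^bold>[\<phi>\<^bold>] Prop p \<^bold>\<longleftrightarrow> (\<phi> \<^bold>\<longrightarrow> Prop p)"
| Ann_Neg: "\<turnstile> \<^bold>[\<phi>\<^bold>] \<^bold>\<not> \<psi> \<^bold>\<longleftrightarrow> (\<phi> \<^bold>\<longrightarrow> \<^bold>\<not> \<^bold>[\<phi>\<^bold>] \<psi>)"
| Ann_Conj: "\<turnstile> \<^bold>[\<phi>\<^bold>] (\<psi> \<^bold>\<and> \<chi>) \<^bold>\<longleftrightarrow> (\<^bold>[\<phi>\<^bold>] \<psi> \<^bold>\<and> \<^bold>[\<phi>\<^bold>] \<chi>)"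
| Ann_Bel: "\<turnstile> \<^bold>[\<phi>\<^bold>] Bel a \<psi> \<chi> \<^bold>\<longleftrightarrow> (\<phi> \<^bold>\<longrightarrow> Bel a (\<phi> \<^bold>\<and> \<^bold>[\<phi>\<^bold>] \<psi>) (\<^bold>[\<phi>\<^bold>] \<chi>))"
| MP: "\<turnstile> \<phi> \<^bold>\<longrightarrow> \<psi> \<Longrightarrow> \<turnstile> \<phi> \<Longrightarrow> \<turnstile> \<psi>"
| NecK: "\<turnstile> \<phi> \<Longrightarrow> \<turnstile> Know a \<phi>"
| RE: "\<turnstile> \<psi> \<^bold>\<longleftrightarrow> \<chi> \<Longrightarrow> \<turnstile> \<^bold>[\<phi>\<^bold>] \<psi> \<^bold>\<longleftrightarrow> \<^bold>[\<phi>\<^bold>] \<chi>"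

text \<open>
  HOL cannot quantify over all types of worlds inside a formula. Worlds are drawn from the type of
  sets of formulas, which is large enough for the canonical model; validity in all models over this
  one type is implied by validity in all models whatsoever.
\<close>

definition valid :: "('p, 'a) fm \<Rightarrow> bool" where
  "valid \<phi> \<longleftrightarrow> (\<forall>M :: (('p, 'a) fm set, 'p, 'a) model.
     cond_nbh_model M \<longrightarrow> (\<forall>w \<in> worlds M. M, w \<Turnstile> \<phi>))"

end

theory Submission
  imports Defs
begin

text \<open>
  The reduction axioms turn every formula into an announcement-free one that is both provably and
  semantically equivalent to it, and the latter are handled by a canonical model. The axioms
  determine the neighbourhoods of that model only on definable sets, whereas the conditions (d) and
  (sc) speak about all sets. The gap is closed combinatorially: the believed definable sets, the sets
  forced by (sc), and, among the remaining undefinable complementary pairs, the members containing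
  a fixed world form a family with both properties that has no further definable member.
\<close>

section \<open>Majority families\<close>

text \<open>
  \<open>D\<close> is the algebra of definable subsets of \<open>U\<close> and \<open>A\<close> the family of those which are believed.
  If \<open>U\<close> is empty, then the value of \<open>SOME\<close> lies in no subset of \<open>U\<close>.
\<close>

definition forced :: "'w set \<Rightarrow> 'w set set \<Rightarrow> 'w set set \<Rightarrow> 'w set \<Rightarrow> bool" where
  "forced U D A Y \<longleftrightarrow> Y \<in> A \<or> (\<exists>Z \<in> D. U - Z \<notin> A \<and> Z \<subset> Y)"

text \<open>The last disjunct breaks ties by a principal ultrafilter: of two complementary
  undefinable subsets of a nonempty \<open>U\<close>, neither forced, it admits the one containing
  the chosen point. The guard \<open>Y \<notin> D\<close> keeps new definable sets out.\<close>

definition majority :: "'w set \<Rightarrow> 'w set set \<Rightarrow> 'w set set \<Rightarrow> 'w set set" where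
  "majority U D A = {Y. Y \<subseteq> U \<and>
     (forced U D A Y \<or> \<not> forced U D A (U - Y) \<and> Y \<notin> D \<and> (SOME x. x \<in> U) \<in> Y)}"

text \<open>\<open>A_compl\<close> and \<open>A_step\<close> are conditions (d) and (sc) relativised
  to the definable sets.\<close>

locale partial_majority =
  fixes U :: "'w set" and D A :: "'w set set"
  assumes D_sub: "Y \<in> D \<Longrightarrow> Y \<subseteq> U"
    and A_sub: "A \<subseteq> D"
    and D_compl: "Y \<in> D \<Longrightarrow> U - Y \<in> D"
    and A_compl: "Y \<in> A \<Longrightarrow> U - Y \<notin> A"
    and A_step: "\<lbrakk>Y \<in> D; Z \<in> D; U - Y \<notin> A; Y \<subset> Z\<rbrakk> \<Longrightarrow> Z \<in> A"
begin

text \<open>A set \<open>Y \<in> A\<close> is itself a witness for its proper supersets, because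
  \<open>A_compl\<close> gives \<open>U - Y \<notin> A\<close>.\<close>

lemma forced_mono: "forced U D A Y \<Longrightarrow> Y \<subset> Z \<Longrightarrow> forced U D A Z"
  unfolding forced_def using A_sub A_compl by (meson psubset_trans subsetD)

lemma forced_definable: "Y \<in> D \<Longrightarrow> forced U D A Y \<longleftrightarrow> Y \<in> A"
  unfolding forced_def using A_step by blast

text \<open>If one of the two sets is definable, so is the other, and \<open>A_compl\<close>
  applies. Otherwise both have witnesses \<open>Z \<subset> Y\<close> and
  \<open>Z' \<subset> U - Y\<close>; then \<open>Z' \<subset> U - Z\<close>, so
  \<open>A_step\<close> puts \<open>U - Z\<close> into \<open>A\<close>, against the choice of
  \<open>Z\<close>.\<close>

lemma not_forced_compl:
  assumes "Y \<subseteq> U" "forced U D A Y"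
  shows "\<not> forced U D A (U - Y)"
proof
  assume other: "forced U D A (U - Y)"
  have dbl: "U - (U - Y) = Y" using assms(1) by blast
  consider "Y \<in> D" | "U - Y \<in> D"
    | Z Z' where "Z \<in> D" "U - Z \<notin> A" "Z \<subset> Y" "Z' \<in> D" "U - Z' \<notin> A" "Z' \<subset> U - Y"
    using assms(2) other A_sub unfolding forced_def by blast
  then show False
  proof cases
    case 1
    then show ?thesis
      using assms(2) other forced_definable D_compl A_compl by blast
  next
    case 2
    then show ?thesis
      using assms(2) other forced_definable D_compl[of "U - Y"] A_compl[of "U - Y"] dbl by auto
  next
    case 3
    have "Z' \<subset> U - Z" using 3 assms(1) by blast
    then show ?thesis using A_step[of Z' "U - Z"] D_compl 3 by blast
  qed
qed

lemma majority_definable: "Y \<in> D \<Longrightarrow> Y \<in> majority U D A \<longleftrightarrow> Y \<in> A"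
  using forced_definable D_sub by (auto simp: majority_def)

lemma majority_compl:
  assumes "Y \<in> majority U D A"
  shows "U - Y \<notin> majority U D A"
proof -
  have "Y \<subseteq> U" "U - (U - Y) = Y" using assms by (auto simp: majority_def)
  then show ?thesis
    using assms not_forced_compl[of Y] by (auto simp: majority_def)
qed

text \<open>If \<open>Z\<close> is not forced, then neither \<open>Y\<close> nor
  \<open>U - Y\<close> is forced, and both are undefinable. As \<open>U - Y\<close> lost the
  tie-break, the chosen point lies in \<open>Y\<close>, hence in \<open>Z\<close>, and
  \<open>Z\<close> wins its own tie-break.\<close>

lemma majority_step:
  assumes Z: "Y \<subset> Z" "Z \<subseteq> U" and Y: "U - Y \<notin> majority U D A"
  shows "Z \<in> majority U D A"
proof (cases "forced U D A Z")
  case True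
  then show ?thesis using Z by (simp add: majority_def)
next
  case False
  have sub: "Y \<subseteq> U" and dbl: "U - (U - Y) = Y" using Z by blast+
  have nfY: "\<not> forced U D A Y" using False forced_mono Z(1) by blast
  have nfY': "\<not> forced U D A (U - Y)" using Y by (auto simp: majority_def)
  \<comment> \<open>A definable \<open>Y\<close> would be a witness that \<open>Z\<close> is
    forced.\<close>
  have "Y \<notin> D"
  proof
    assume "Y \<in> D"
    moreover from this have "U - Y \<notin> A" using nfY' by (auto simp: forced_def)
    ultimately show False using False Z(1) by (auto simp: forced_def)
  qed
  then have "U - Y \<notin> D" using D_compl[of "U - Y"] dbl by auto
  moreover have "U \<noteq> {}" using Z by blast
  then have "(SOME x. x \<in> U) \<in> U" by (rule some_in_eq[THEN iffD2])
  ultimately have "(SOME x. x \<in> U) \<in> Y"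
    using Y nfY dbl by (auto simp: majority_def)
  moreover have compl_step: "U - Z \<subset> U - Y" using Z by blast
  then have "\<not> forced U D A (U - Z)" using nfY' forced_mono by blast
  \<comment> \<open>If \<open>Z\<close> were definable, then \<open>U - Z\<close> would be a witness
    that \<open>U - Y\<close> is forced, since its complement \<open>Z\<close> is not in
    \<open>A\<close>.\<close>
  moreover have "Z \<notin> D"
  proof
    assume "Z \<in> D"
    moreover have "U - (U - Z) = Z" using Z(2) by blast
    moreover have "Z \<notin> A" using False by (simp add: forced_def)
    ultimately show False
      using nfY' D_compl compl_step unfolding forced_def by metis
  qed
  ultimately show ?thesis using Z by (auto simp: majority_def)
qed

lemma majority_mono:
  "\<lbrakk>Y \<in> majority U D A; Y \<subseteq> Z; Z \<subseteq> U\<rbrakk> \<Longrightarrow> Z \<in> majority U D A"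
  using majority_compl majority_step by (metis psubsetI)

end


section \<open>Maximal consistent sets\<close>

lemma taut_MP: "tautology (\<phi> \<^bold>\<longrightarrow> \<psi>) \<Longrightarrow> \<turnstile> \<phi> \<Longrightarrow> \<turnstile> \<psi>"
  by (rule MP[OF Taut])

lemma taut_MP2: "tautology (\<phi> \<^bold>\<longrightarrow> \<psi> \<^bold>\<longrightarrow> \<chi>) \<Longrightarrow> \<turnstile> \<phi> \<Longrightarrow> \<turnstile> \<psi> \<Longrightarrow> \<turnstile> \<chi>"
  by (rule MP[OF MP[OF Taut]])

section \<open>Derivability from hypotheses\<close>

text \<open>\<open>NecK\<close> and \<open>RE\<close> act on theorems only, through
  \<open>prov\<close>. Hypotheses are combined by modus ponens alone, which is what makes the
  deduction theorem hold.\<close>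

inductive deriv :: "('p, 'a) fm set \<Rightarrow> ('p, 'a) fm \<Rightarrow> bool" for S where
  hyp: "\<phi> \<in> S \<Longrightarrow> deriv S \<phi>"
| prov: "\<turnstile> \<phi> \<Longrightarrow> deriv S \<phi>"
| mp: "deriv S (\<phi> \<^bold>\<longrightarrow> \<psi>) \<Longrightarrow> deriv S \<phi> \<Longrightarrow> deriv S \<psi>"

lemma deriv_taut: "tautology (\<phi> \<^bold>\<longrightarrow> \<psi>) \<Longrightarrow> deriv S \<phi> \<Longrightarrow> deriv S \<psi>"
  by (rule mp[OF prov[OF Taut]])

lemma deriv_taut2:
  "tautology (\<phi> \<^bold>\<longrightarrow> \<psi> \<^bold>\<longrightarrow> \<chi>) \<Longrightarrow> deriv S \<phi> \<Longrightarrow> deriv S \<psi> \<Longrightarrow> deriv S \<chi>"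
  by (rule mp[OF mp[OF prov[OF Taut]]])

lemma deriv_mono: "deriv S \<phi> \<Longrightarrow> S \<subseteq> S' \<Longrightarrow> deriv S' \<phi>"
proof (induction rule: deriv.induct)
  case (mp \<phi> \<psi>)
  then show ?case by (blast intro: deriv.mp)
qed (auto intro: hyp prov)

lemma deriv_finite: "deriv S \<phi> \<Longrightarrow> \<exists>F. finite F \<and> F \<subseteq> S \<and> deriv F \<phi>"
proof (induction rule: deriv.induct)
  case (hyp \<phi>)
  then show ?case by (intro exI[of _ "{\<phi>}"]) (auto intro: deriv.hyp)
next
  case (prov \<phi>)
  then show ?case by (auto intro: deriv.prov)
next
  case (mp \<phi> \<psi>)
  then obtain F G where F: "finite F" "F \<subseteq> S" "deriv F (\<phi> \<^bold>\<longrightarrow> \<psi>)"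
    and G: "finite G" "G \<subseteq> S" "deriv G \<phi>"
    by metis
  have "deriv (F \<union> G) \<psi>"
    by (rule deriv.mp[OF deriv_mono[OF F(3)] deriv_mono[OF G(3)]]) simp_all
  then show ?case using F G by (intro exI[of _ "F \<union> G"]) simp
qed

lemma deduction: "deriv (insert \<phi> S) \<psi> \<Longrightarrow> deriv S (\<phi> \<^bold>\<longrightarrow> \<psi>)"
proof (induction rule: deriv.induct)
  case (hyp \<psi>)
  have "deriv S (\<phi> \<^bold>\<longrightarrow> \<phi>)" by (rule prov, rule Taut) (simp add: tautology_def)
  moreover have "deriv S (\<phi> \<^bold>\<longrightarrow> \<psi>)" if "\<psi> \<in> S"
    by (rule deriv_taut[OF _ deriv.hyp[OF that]]) (simp add: tautology_def)
  ultimately show ?case using hyp by blast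
next
  case (prov \<psi>)
  show ?case by (rule deriv_taut[OF _ deriv.prov[OF prov]]) (simp add: tautology_def)
next
  case (mp \<psi> \<chi>)
  show ?case by (rule deriv_taut2[OF _ mp.IH]) (simp add: tautology_def)
qed

lemma deriv_empty: "deriv {} \<phi> \<Longrightarrow> \<turnstile> \<phi>"
proof (induction rule: deriv.induct)
  case (mp \<phi> \<psi>)
  then show ?case by (blast intro: MP[of \<phi>])
qed simp_all

section \<open>Consistency and Lindenbaum's lemma\<close>

definition consistent :: "('p, 'a) fm set \<Rightarrow> bool" where
  "consistent S \<longleftrightarrow> \<not> deriv S (\<^bold>\<not> \<^bold>\<top>)"

definition mcs :: "('p, 'a) fm set \<Rightarrow> bool" where
  "mcs w \<longleftrightarrow> consistent w \<and> (\<forall>S. consistent S \<longrightarrow> w \<subseteq> S \<longrightarrow> S = w)"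

lemma consistent_insert_neg:
  assumes "\<not> deriv S \<phi>"
  shows "consistent (insert (\<^bold>\<not> \<phi>) S)"
  unfolding consistent_def
proof
  assume "deriv (insert (\<^bold>\<not> \<phi>) S) (\<^bold>\<not> \<^bold>\<top>)"
  from deduction[OF this] have "deriv S \<phi>"
    by (rule deriv_taut[rotated]) (simp add: tautology_def)
  then show False using assms by blast
qed

text \<open>Zorn's lemma places no bound on the cardinality of the language. An inconsistency of the
  union of a chain uses finitely many formulas, which already lie in one member of the
  chain.\<close>

lemma lindenbaum:
  assumes "consistent S"
  shows "\<exists>w. mcs w \<and> S \<subseteq> w"
proof -
  let ?\<A> = "{S'. consistent S' \<and> S \<subseteq> S'}"
  have "\<exists>w \<in> ?\<A>. \<forall>X \<in> ?\<A>. w \<subseteq> X \<longrightarrow> X = w"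
  proof (rule subset_Zorn_nonempty)
    show "?\<A> \<noteq> {}" using assms by blast
  next
    fix \<C> assume ne: "\<C> \<noteq> {}" and "subset.chain ?\<A> \<C>"
    then have sub: "\<C> \<subseteq> ?\<A>" and chain: "subset.chain \<C> \<C>"
      by (auto simp: subset.chain_def)
    have "consistent (\<Union>\<C>)"
      unfolding consistent_def
    proof
      assume "deriv (\<Union>\<C>) (\<^bold>\<not> \<^bold>\<top>)"
      then obtain F where F: "finite F" "F \<subseteq> \<Union>\<C>" "deriv F (\<^bold>\<not> \<^bold>\<top>)"
        using deriv_finite by blast
      then obtain X where "X \<in> \<C>" "F \<subseteq> X"
        using finite_subset_Union_chain[OF F(1,2) ne chain] by blast
      then show False using F(3) deriv_mono sub unfolding consistent_def by blast
    qed
    then show "\<Union>\<C> \<in> ?\<A>" using sub ne by blast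
  qed
  then show ?thesis unfolding mcs_def by (metis (mono_tags, lifting) mem_Collect_eq subset_trans)
qed

context
  fixes w :: "('p, 'a) fm set"
  assumes w: "mcs w"
begin

text \<open>By the deduction theorem, adding a derivable formula preserves consistency, so
  maximality forces it to be a member already.\<close>

lemma mcs_deriv: "deriv w \<phi> \<longleftrightarrow> \<phi> \<in> w"
proof
  assume d: "deriv w \<phi>"
  have "consistent (insert \<phi> w)"
    unfolding consistent_def
  proof
    assume "deriv (insert \<phi> w) (\<^bold>\<not> \<^bold>\<top>)"
    from mp[OF deduction[OF this] d] have "deriv w (\<^bold>\<not> \<^bold>\<top>)" .
    then show False using w by (simp add: mcs_def consistent_def)
  qed
  then show "\<phi> \<in> w" using w unfolding mcs_def by blast
qed (rule hyp)

lemma mcs_thm: "\<turnstile> \<phi> \<Longrightarrow> \<phi> \<in> w"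
  using mcs_deriv prov by blast

lemma mcs_neg [simp]: "\<^bold>\<not> \<phi> \<in> w \<longleftrightarrow> \<phi> \<notin> w"
proof
  assume "\<^bold>\<not> \<phi> \<in> w"
  show "\<phi> \<notin> w"
  proof
    assume "\<phi> \<in> w"
    have "deriv w (\<^bold>\<not> \<^bold>\<top>)"
      by (rule deriv_taut2[OF _ hyp[OF \<open>\<phi> \<in> w\<close>] hyp[OF \<open>\<^bold>\<not> \<phi> \<in> w\<close>]])
        (simp add: tautology_def)
    then show False using w by (simp add: mcs_def consistent_def)
  qed
next
  assume "\<phi> \<notin> w"
  then have "consistent (insert (\<^bold>\<not> \<phi>) w)"
    using consistent_insert_neg mcs_deriv by blast
  then show "\<^bold>\<not> \<phi> \<in> w" using w unfolding mcs_def by blast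
qed

lemma mcs_conj [simp]: "\<phi> \<^bold>\<and> \<psi> \<in> w \<longleftrightarrow> \<phi> \<in> w \<and> \<psi> \<in> w"
proof -
  have "deriv w \<phi>" "deriv w \<psi>" if "deriv w (\<phi> \<^bold>\<and> \<psi>)"
    by (rule deriv_taut[OF _ that], simp add: tautology_def)+
  moreover have "deriv w (\<phi> \<^bold>\<and> \<psi>)" if "deriv w \<phi>" "deriv w \<psi>"
    by (rule deriv_taut2[OF _ that]) (simp add: tautology_def)
  ultimately show ?thesis by (auto simp: mcs_deriv)
qed

lemma mcs_truth [simp]: "\<^bold>\<top> \<in> w"
  by (rule mcs_thm, rule Taut) (simp add: tautology_def)

end


section \<open>Canonical model\<close>

definition ext :: "('p, 'a) fm \<Rightarrow> ('p, 'a) fm set set" where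
  "ext \<phi> = {w. mcs w \<and> \<phi> \<in> w}"

text \<open>Indistinguishability is defined syntactically first, because the canonical
  neighbourhoods refer to it; \<open>cell_canonical\<close> later identifies it with the cells
  induced by those neighbourhoods.\<close>

definition ccell :: "'a \<Rightarrow> ('p, 'a) fm set \<Rightarrow> ('p, 'a) fm set set" where
  "ccell a w = {v. mcs v \<and> (\<forall>\<phi> \<psi>. Bel a \<phi> \<psi> \<in> v \<longleftrightarrow> Bel a \<phi> \<psi> \<in> w)}"

lemma ext_Conj: "ext (\<phi> \<^bold>\<and> \<psi>) = ext \<phi> \<inter> ext \<psi>"
  by (auto simp: ext_def)

lemma ext_Neg: "ext (\<^bold>\<not> \<phi>) = {w. mcs w} - ext \<phi>"
  by (auto simp: ext_def)

lemma ccell_mcs: "v \<in> ccell a w \<Longrightarrow> mcs v"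
  by (simp add: ccell_def)

lemma ccell_refl: "mcs w \<Longrightarrow> w \<in> ccell a w"
  by (simp add: ccell_def)

lemma ccell_eq: "v \<in> ccell a w \<Longrightarrow> ccell a v = ccell a w"
  by (auto simp: ccell_def)

lemma ccell_int: "S \<inter> ccell a w = S' \<inter> ccell a w \<longleftrightarrow> (\<forall>v \<in> ccell a w. v \<in> S \<longleftrightarrow> v \<in> S')"
  by blast

lemma know_deriv:
  assumes "mcs w" "deriv {\<psi>. Know a \<psi> \<in> w} \<phi>"
  shows "Know a \<phi> \<in> w"
  using assms(2)
proof (induction rule: deriv.induct)
  case (hyp \<phi>)
  then show ?case by simp
next
  case (prov \<phi>)
  then show ?case using mcs_thm[OF assms(1) NecK] by blast
next
  case (mp \<phi> \<psi>)
  then show ?case using mcs_thm[OF assms(1) DistK[of a \<phi> \<psi>]] assms(1) by simp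
qed

text \<open>The existence lemma for \<open>Know\<close>, stated in the form to which
  \<open>mcs_neg\<close> simplifies membership of \<open>Know a \<phi>\<close>. Forwards, a
  knowledge formula is a negated \<open>Bel\<close> formula, hence shared by the whole cell, and
  \<open>T\<close> applies.\<close>

lemma know_iff:
  assumes w: "mcs w"
  shows "Bel a (\<^bold>\<not> \<phi>) \<^bold>\<top> \<notin> w \<longleftrightarrow> (\<forall>v \<in> ccell a w. \<phi> \<in> v)"
proof
  assume k: "Bel a (\<^bold>\<not> \<phi>) \<^bold>\<top> \<notin> w"
  show "\<forall>v \<in> ccell a w. \<phi> \<in> v"
  proof
    fix v assume v: "v \<in> ccell a w"
    then have "Know a \<phi> \<in> v" using k by (simp add: ccell_def)
    then show "\<phi> \<in> v" using mcs_thm[OF _ T[of a \<phi>], of v] ccell_mcs[OF v] by simp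
  qed
next
  assume all: "\<forall>v \<in> ccell a w. \<phi> \<in> v"
  show "Bel a (\<^bold>\<not> \<phi>) \<^bold>\<top> \<notin> w"
  proof
    assume "Bel a (\<^bold>\<not> \<phi>) \<^bold>\<top> \<in> w"
    then have "\<not> deriv {\<psi>. Know a \<psi> \<in> w} \<phi>"
      using know_deriv[OF w, of a \<phi>] w by auto
    then obtain v where v: "mcs v" "insert (\<^bold>\<not> \<phi>) {\<psi>. Know a \<psi> \<in> w} \<subseteq> v"
      using lindenbaum consistent_insert_neg by metis
    then have K: "\<psi> \<in> v" if "Know a \<psi> \<in> w" for \<psi> using that by blast
    \<comment> \<open>By \<open>FiveB\<close> and \<open>FourB\<close> each belief formula or its
      negation is known at \<open>w\<close>, so \<open>v\<close> decides all of them as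
      \<open>w\<close> does.\<close>
    have "Bel a \<psi> \<chi> \<in> v \<longleftrightarrow> Bel a \<psi> \<chi> \<in> w" for \<psi> \<chi>
      using mcs_thm[OF w FiveB[of a \<psi> \<chi>]] mcs_thm[OF w FourB[of a \<psi> \<chi>]]
        K[of "Bel a \<psi> \<chi>"] K[of "\<^bold>\<not> Bel a \<psi> \<chi>"] w v(1) by auto
    then have "v \<in> ccell a w" using v(1) by (simp add: ccell_def)
    then show False using all v by auto
  qed
qed

lemma bel_cong:
  assumes w: "mcs w" and "ext \<phi> \<inter> ccell a w = ext \<psi> \<inter> ccell a w" "Bel a \<phi> \<chi> \<in> w"
  shows "Bel a \<psi> \<chi> \<in> w"
proof -
  have "\<forall>v \<in> ccell a w. (\<phi> \<^bold>\<longleftrightarrow> \<psi>) \<in> v"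
    using assms(2) by (auto simp: ccell_int ext_def ccell_mcs)
  then have "Know a (\<phi> \<^bold>\<longleftrightarrow> \<psi>) \<in> w" using know_iff[OF w] w by simp
  then show ?thesis using mcs_thm[OF w EC[of a \<phi> \<psi> \<chi>]] assms(3) w by simp
qed

text \<open>\<open>C\<close> first adds the condition to the believed formula, so that the inclusion
  is needed only inside \<open>ext \<chi>\<close> before \<open>M\<close> is applied.\<close>

lemma bel_mono:
  assumes w: "mcs w" and "ext \<chi> \<inter> ext \<phi> \<inter> ccell a w \<subseteq> ext \<psi>" "Bel a \<chi> \<phi> \<in> w"
  shows "Bel a \<chi> \<psi> \<in> w"
proof -
  have "\<forall>v \<in> ccell a w. (\<chi> \<^bold>\<and> \<phi> \<^bold>\<longrightarrow> \<psi>) \<in> v"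
    using assms(2) ccell_mcs by (fastforce simp: ext_def)
  then have "Know a (\<chi> \<^bold>\<and> \<phi> \<^bold>\<longrightarrow> \<psi>) \<in> w" using know_iff[OF w] w by simp
  then show ?thesis
    using mcs_thm[OF w M[of a "\<chi> \<^bold>\<and> \<phi>" \<psi> \<chi>]] mcs_thm[OF w C[of a \<chi> \<phi>]] assms(3) w by simp
qed

lemma bel_step:
  assumes w: "mcs w" and "Bel a \<chi> (\<^bold>\<not> \<phi>) \<notin> w"
    and v: "v \<in> ccell a w" "\<chi> \<in> v" "\<phi> \<notin> v" "\<psi> \<in> v"
  shows "Bel a \<chi> (\<phi> \<^bold>\<or> \<psi>) \<in> w"
proof -
  have "Poss a (\<chi> \<^bold>\<and> \<^bold>\<not> \<phi> \<^bold>\<and> \<psi>) \<in> w"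
    using know_iff[OF w, of a "\<^bold>\<not> (\<chi> \<^bold>\<and> \<^bold>\<not> \<phi> \<^bold>\<and> \<psi>)"] v ccell_mcs[OF v(1)] w by auto
  then show ?thesis using mcs_thm[OF w SC[of a \<chi> \<phi> \<psi>]] assms(2) w by simp
qed

section \<open>Canonical neighbourhoods\<close>

text \<open>The family is empty if no formula cuts \<open>U\<close> out of the cell; the tie-break
  alone then determines the neighbourhoods.\<close>

definition definable :: "'a \<Rightarrow> ('p, 'a) fm set \<Rightarrow> ('p, 'a) fm set set \<Rightarrow> ('p, 'a) fm set set set" where
  "definable a w U = {ext \<psi> \<inter> U |\<phi> \<psi>. ext \<phi> \<inter> ccell a w = U}"

definition believed :: "'a \<Rightarrow> ('p, 'a) fm set \<Rightarrow> ('p, 'a) fm set set \<Rightarrow> ('p, 'a) fm set set set" where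
  "believed a w U = {ext \<psi> \<inter> U |\<phi> \<psi>. ext \<phi> \<inter> ccell a w = U \<and> Bel a \<phi> \<psi> \<in> w}"

text \<open>Independence of the representing formulas: \<open>bel_cong\<close> exchanges the
  condition and \<open>bel_mono\<close> the believed formula.\<close>

lemma believed_iff:
  assumes w: "mcs w" and U: "ext \<phi> \<inter> ccell a w = U"
  shows "ext \<psi> \<inter> U \<in> believed a w U \<longleftrightarrow> Bel a \<phi> \<psi> \<in> w"
proof
  assume "ext \<psi> \<inter> U \<in> believed a w U"
  then obtain \<phi>' \<psi>' where *: "ext \<phi>' \<inter> ccell a w = U" "Bel a \<phi>' \<psi>' \<in> w" "ext \<psi> \<inter> U = ext \<psi>' \<inter> U"
    unfolding believed_def by blast
  then have "Bel a \<phi> \<psi>' \<in> w" using bel_cong[OF w] U by metis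
  then show "Bel a \<phi> \<psi> \<in> w" by (rule bel_mono[OF w, rotated]) (use * U in blast)
next
  assume "Bel a \<phi> \<psi> \<in> w"
  then show "ext \<psi> \<inter> U \<in> believed a w U" using U unfolding believed_def by blast
qed

lemma ext_diff: "U \<subseteq> ccell a w \<Longrightarrow> U - ext \<psi> \<inter> U = ext (\<^bold>\<not> \<psi>) \<inter> U"
  by (auto simp: ext_Neg ccell_mcs)

lemma partial_majority_canonical:
  assumes w: "mcs w" and U: "U \<subseteq> ccell a w"
  shows "partial_majority U (definable a w U) (believed a w U)"
proof
  show "believed a w U \<subseteq> definable a w U"
    unfolding believed_def definable_def by blast
next
  fix Y assume "Y \<in> definable a w U"
  then show "U - Y \<in> definable a w U"
    unfolding definable_def using ext_diff[OF U] by blast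
next
  fix Y assume "Y \<in> believed a w U"
  then obtain \<phi> \<psi> where *: "ext \<phi> \<inter> ccell a w = U" "Bel a \<phi> \<psi> \<in> w" "Y = ext \<psi> \<inter> U"
    unfolding believed_def by blast
  then have "Bel a \<phi> (\<^bold>\<not> \<psi>) \<notin> w" using mcs_thm[OF w D[of a \<phi> \<psi>]] w by simp
  then show "U - Y \<notin> believed a w U"
    using believed_iff[OF w *(1)] ext_diff[OF U] *(3) by auto
next
  fix Y Z
  assume "Y \<in> definable a w U" "Z \<in> definable a w U" "U - Y \<notin> believed a w U" "Y \<subset> Z"
  then obtain \<phi> \<psi> \<chi> where *: "ext \<phi> \<inter> ccell a w = U" "Y = ext \<psi> \<inter> U" "Z = ext \<chi> \<inter> U"
    unfolding definable_def by blast
  then have "ext (\<^bold>\<not> \<psi>) \<inter> U \<notin> believed a w U"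
    using \<open>U - Y \<notin> believed a w U\<close> ext_diff[OF U] by simp
  then have "Bel a \<phi> (\<^bold>\<not> \<psi>) \<notin> w" using believed_iff[OF w *(1)] by blast
  \<comment> \<open>The world \<open>v\<close> witnesses the possibility premise of
    \<open>SC\<close>. The resulting belief in the disjunction of \<open>\<psi>\<close> and
    \<open>\<chi>\<close> is a belief in \<open>\<chi>\<close>, as both have trace \<open>Z\<close>
    on \<open>U\<close>.\<close>
  moreover obtain v where "v \<in> Z" "v \<notin> Y" using \<open>Y \<subset> Z\<close> by blast
  ultimately have "Bel a \<phi> (\<psi> \<^bold>\<or> \<chi>) \<in> w"
    using * by (intro bel_step[OF w, of _ _ _ v]) (auto simp: ext_def)
  then have "Bel a \<phi> \<chi> \<in> w"
    by (rule bel_mono[OF w, rotated]) (use * \<open>Y \<subset> Z\<close> in \<open>auto simp: ext_Neg ext_Conj\<close>)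
  then show "Z \<in> believed a w U" using believed_iff[OF w *(1)] *(3) by blast
qed (auto simp: definable_def)

text \<open>Neighbourhoods depend on \<open>X\<close> only through
  \<open>X \<inter> ccell a w\<close>, which builds in (ec).\<close>

definition canonical :: "(('p, 'a) fm set, 'p, 'a) model" where
  "canonical = \<lparr>worlds = {w. mcs w},
     nbh = \<lambda>a w X. majority (X \<inter> ccell a w) (definable a w (X \<inter> ccell a w)) (believed a w (X \<inter> ccell a w)),
     val = \<lambda>p. ext (Prop p)\<rparr>"

lemma worlds_canonical: "worlds canonical = {w. mcs w}"
  by (simp add: canonical_def)

lemma nbh_canonical:
  "nbh canonical a w X =
    majority (X \<inter> ccell a w) (definable a w (X \<inter> ccell a w)) (believed a w (X \<inter> ccell a w))"
  by (simp add: canonical_def)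

lemma nbh_canonical_sub: "Y \<in> nbh canonical a w X \<Longrightarrow> Y \<subseteq> X \<inter> ccell a w"
  by (simp add: nbh_canonical majority_def)

lemma nbh_canonical_ext:
  assumes "mcs w"
  shows "ext \<psi> \<inter> (ext \<phi> \<inter> ccell a w) \<in> nbh canonical a w (ext \<phi>) \<longleftrightarrow> Bel a \<phi> \<psi> \<in> w"
proof -
  interpret partial_majority "ext \<phi> \<inter> ccell a w" "definable a w (ext \<phi> \<inter> ccell a w)"
    "believed a w (ext \<phi> \<inter> ccell a w)"
    by (rule partial_majority_canonical) (use assms in auto)
  have "ext \<psi> \<inter> (ext \<phi> \<inter> ccell a w) \<in> definable a w (ext \<phi> \<inter> ccell a w)"
    unfolding definable_def by blast
  then show ?thesis
    using majority_definable believed_iff[OF assms refl] by (simp add: nbh_canonical)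
qed

text \<open>Agreement on belief formulas gives equal definable and believed families, hence equal
  neighbourhoods. Conversely, \<open>ccell a v\<close> is a neighbourhood of \<open>v\<close> for
  the set of all worlds; if \<open>w\<close> has the same neighbourhoods, then
  \<open>ccell a v\<close> lies inside \<open>ccell a w\<close>.\<close>

lemma cell_canonical:
  fixes w :: "('p, 'a) fm set"
  assumes w: "mcs w"
  shows "cell canonical a w = ccell a w"
proof
  show "ccell a w \<subseteq> cell canonical a w"
  proof
    fix v assume v: "v \<in> ccell a w"
    then have "definable a v = definable a w" "believed a v = believed a w"
      unfolding definable_def believed_def ccell_eq[OF v] by (auto simp: ccell_def)
    then show "v \<in> cell canonical a w"
      using ccell_eq[OF v] ccell_mcs[OF v] by (simp add: cell_def nbh_canonical worlds_canonical)
  qed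
next
  show "cell canonical a w \<subseteq> ccell a w"
  proof
    fix v assume v: "v \<in> cell canonical a w"
    then have "mcs v" by (simp add: cell_def worlds_canonical)
    have top: "ext (\<^bold>\<top> :: ('p, 'a) fm) = {w. mcs w}" by (auto simp: ext_def)
    \<comment> \<open>Falsity is not known at \<open>v\<close>, since \<open>v\<close> belongs to
      its own cell; the double negation comes from unfolding \<open>Know\<close>.\<close>
    have "Bel a (\<^bold>\<not> \<^bold>\<not> \<^bold>\<top>) \<^bold>\<top> \<in> v"
      using know_iff[OF \<open>mcs v\<close>, of a "\<^bold>\<not> \<^bold>\<top>"] ccell_refl[OF \<open>mcs v\<close>, of a] \<open>mcs v\<close>
        mcs_neg[OF \<open>mcs v\<close>] mcs_truth[OF \<open>mcs v\<close>] by blast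
    then have "Bel a \<^bold>\<top> \<^bold>\<top> \<in> v"
      by (rule bel_cong[OF \<open>mcs v\<close>, rotated]) (auto simp: ext_def)
    moreover have "ext \<^bold>\<top> \<inter> ccell a v = ccell a v" using ccell_mcs by (auto simp: top)
    ultimately have "ccell a v \<in> nbh canonical a v (ext \<^bold>\<top>)"
      using nbh_canonical_ext[OF \<open>mcs v\<close>, of "\<^bold>\<top>" "\<^bold>\<top>" a] by simp
    also have "nbh canonical a v (ext \<^bold>\<top>) = nbh canonical a w (ext \<^bold>\<top>)"
      using v by (simp add: cell_def top worlds_canonical)
    finally have "ccell a v \<subseteq> ccell a w" by (rule nbh_canonical_sub[THEN le_infE])
    then show "v \<in> ccell a w" using ccell_refl[OF \<open>mcs v\<close>] by blast
  qed
qed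

text \<open>The given \<open>w\<close> makes the set of worlds nonempty. That such a set exists
  amounts to consistency of the calculus, so taking it as a hypothesis avoids a soundness
  proof.\<close>

lemma cond_nbh_model_canonical:
  assumes "mcs (w :: ('p, 'a) fm set)"
  shows "cond_nbh_model (canonical :: (('p, 'a) fm set, 'p, 'a) model)"
proof
  let ?M = "canonical :: (('p, 'a) fm set, 'p, 'a) model"
  show "worlds ?M \<noteq> {}" using assms by (auto simp: worlds_canonical)
  show "val ?M p \<subseteq> worlds ?M" for p by (auto simp: canonical_def ext_def)
  fix w X a assume "w \<in> worlds ?M" "X \<subseteq> worlds ?M"
  then have w: "mcs w" by (simp add: worlds_canonical)
  then interpret partial_majority "X \<inter> ccell a w" "definable a w (X \<inter> ccell a w)"
    "believed a w (X \<inter> ccell a w)"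
    by (rule partial_majority_canonical) simp
  show "nbh ?M a w X \<subseteq> Pow (worlds ?M)"
    using nbh_canonical_sub ccell_mcs by (fastforce simp: worlds_canonical)
  fix Y
  show "nbh ?M a w X = nbh ?M a w Y" if "X \<inter> cell ?M a w = Y \<inter> cell ?M a w"
    using that by (simp add: nbh_canonical cell_canonical[OF w])
  show "Z \<in> nbh ?M a w X" if "Z \<subseteq> X \<inter> cell ?M a w"
    "X \<inter> cell ?M a w - Y \<notin> nbh ?M a w X" "Y \<subset> Z" for Z
    using that majority_step by (simp add: nbh_canonical cell_canonical[OF w])
  assume Y: "Y \<in> nbh ?M a w X"
  show "Y \<subseteq> X \<inter> cell ?M a w"
    using nbh_canonical_sub[OF Y] by (simp add: cell_canonical[OF w])
  show "X \<inter> cell ?M a w - Y \<notin> nbh ?M a w X"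
    using Y majority_compl by (simp add: nbh_canonical cell_canonical[OF w])
qed

section \<open>Truth lemma for announcement-free formulas\<close>

primrec static :: "('p, 'a) fm \<Rightarrow> bool" where
  "static \<^bold>\<top> \<longleftrightarrow> True"
| "static (Prop p) \<longleftrightarrow> True"
| "static (\<^bold>\<not> \<phi>) \<longleftrightarrow> static \<phi>"
| "static (\<phi> \<^bold>\<and> \<psi>) \<longleftrightarrow> static \<phi> \<and> static \<psi>"
| "static (Bel a \<phi> \<psi>) \<longleftrightarrow> static \<phi> \<and> static \<psi>"
| "static (\<^bold>[\<phi>\<^bold>] \<psi>) \<longleftrightarrow> False"

lemma truth_lemma:
  fixes \<phi> :: "('p, 'a) fm"
  shows "static \<phi> \<Longrightarrow> mcs w \<Longrightarrow> (canonical, w \<Turnstile> \<phi>) \<longleftrightarrow> \<phi> \<in> w"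
proof (induction \<phi> arbitrary: w)
  case (Bel a \<phi> \<psi>)
  have ext: "{v \<in> worlds canonical. canonical, v \<Turnstile> \<phi>} = ext \<phi>"
    "{v \<in> worlds canonical. canonical, v \<Turnstile> \<psi>} = ext \<psi>"
    using Bel by (auto simp: ext_def worlds_canonical)
  interpret partial_majority "ext \<phi> \<inter> ccell a w" "definable a w (ext \<phi> \<inter> ccell a w)"
    "believed a w (ext \<phi> \<inter> ccell a w)"
    by (rule partial_majority_canonical) (use Bel in auto)
  \<comment> \<open>Neighbourhoods are closed upwards within
    \<open>ext \<phi> \<inter> ccell a w\<close>, so it suffices to test the largest candidate,
    which is definable.\<close>
  have "(\<exists>Y \<in> nbh canonical a w (ext \<phi>). Y \<subseteq> ext \<psi>)
    \<longleftrightarrow> ext \<psi> \<inter> (ext \<phi> \<inter> ccell a w) \<in> nbh canonical a w (ext \<phi>)" (is "?L \<longleftrightarrow> ?R")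
  proof
    assume ?L
    then obtain Y where Y: "Y \<in> nbh canonical a w (ext \<phi>)" "Y \<subseteq> ext \<psi>" by blast
    then have "Y \<subseteq> ext \<psi> \<inter> (ext \<phi> \<inter> ccell a w)" using nbh_canonical_sub[OF Y(1)] by blast
    then show ?R using majority_mono[OF Y(1)[unfolded nbh_canonical]] unfolding nbh_canonical by blast
  qed blast
  then show ?case using nbh_canonical_ext Bel.prems(2) by (simp add: ext)
qed (simp_all add: canonical_def ext_def)


section \<open>Elimination of announcements\<close>

context cond_nbh_model
begin

lemma cell_refl: "w \<in> worlds M \<Longrightarrow> w \<in> cell M a w"
  by (simp add: cell_def)

text \<open>Condition (sc) applied to the empty set, whose complement is the full set.\<close>

lemma full_nbh:
  assumes "w \<in> worlds M" "X \<subseteq> worlds M" "X \<inter> cell M a w \<noteq> {}"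
  shows "X \<inter> cell M a w \<in> nbh M a w X"
proof (rule ccontr)
  assume "X \<inter> cell M a w \<notin> nbh M a w X"
  then show False using sc[OF assms(1,2), of "{}" a "X \<inter> cell M a w"] assms(3) by auto
qed

text \<open>A restricted cell compares neighbourhoods only for subsets of \<open>S\<close>, but
  \<open>S\<close> alone suffices: \<open>S \<inter> cell M a v\<close> is a neighbourhood of
  \<open>v\<close> for \<open>S\<close>, hence of \<open>w\<close>, and (c) places it, with
  \<open>v\<close> in it, inside the cell of \<open>w\<close>.\<close>

lemma cell_restrict:
  assumes S: "S \<subseteq> worlds M" and w: "w \<in> S"
  shows "cell (restrict_model M S) a w = cell M a w \<inter> S"
proof
  show "cell M a w \<inter> S \<subseteq> cell (restrict_model M S) a w"
    using S by (auto simp: cell_def restrict_model_def)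
  show "cell (restrict_model M S) a w \<subseteq> cell M a w \<inter> S"
  proof
    fix v assume v: "v \<in> cell (restrict_model M S) a w"
    then have "v \<in> S" "nbh M a w S = nbh M a v S" by (auto simp: cell_def restrict_model_def)
    moreover have "S \<inter> cell M a v \<in> nbh M a v S"
      using full_nbh[of v S a] S \<open>v \<in> S\<close> cell_refl[of v a] by blast
    ultimately have "S \<inter> cell M a v \<subseteq> cell M a w" using c[of w S "S \<inter> cell M a v" a] S w by blast
    then show "v \<in> cell M a w \<inter> S" using \<open>v \<in> S\<close> cell_refl[of v a] S by blast
  qed
qed

lemma cond_nbh_model_restrict:
  assumes S: "S \<subseteq> worlds M" and ne: "S \<noteq> {}"
  shows "cond_nbh_model (restrict_model M S)"
proof
  let ?M = "restrict_model M S"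
  have simps: "worlds ?M = S" "nbh ?M = nbh M" by (simp_all add: restrict_model_def)
  show "worlds ?M \<noteq> {}" using ne by (simp add: simps)
  show "val ?M p \<subseteq> worlds ?M" for p by (simp add: restrict_model_def)
  fix w X a assume "w \<in> worlds ?M" "X \<subseteq> worlds ?M"
  then have w: "w \<in> S" "w \<in> worlds M" and X: "X \<subseteq> S" "X \<subseteq> worlds M" using S by (auto simp: simps)
  \<comment> \<open>Below \<open>S\<close> the two cells have the same traces, so every condition is
    inherited from \<open>M\<close>.\<close>
  have cell: "Z \<inter> cell ?M a w = Z \<inter> cell M a w" if "Z \<subseteq> S" for Z
    using that cell_restrict[OF S w(1)] by blast
  show "nbh ?M a w X \<subseteq> Pow (worlds ?M)" using c[OF w(2) X(2)] X(1) by (fastforce simp: simps)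
  fix Y
  show "nbh ?M a w X = nbh ?M a w Y" if "Y \<subseteq> worlds ?M" "X \<inter> cell ?M a w = Y \<inter> cell ?M a w"
    using ec[OF w(2) X(2), of Y a] that S X(1) by (simp add: simps cell)
  show "Z \<in> nbh ?M a w X" if "Y \<subseteq> X \<inter> cell ?M a w" "Z \<subseteq> X \<inter> cell ?M a w"
    "X \<inter> cell ?M a w - Y \<notin> nbh ?M a w X" "Y \<subset> Z" for Z
    using that sc[OF w(2) X(2)] X by (simp add: simps cell)
  assume Y: "Y \<in> nbh ?M a w X"
  show "Y \<subseteq> X \<inter> cell ?M a w"
    using Y c[OF w(2) X(2)] X by (simp add: simps cell)
  show "X \<inter> cell ?M a w - Y \<notin> nbh ?M a w X"
    using Y d[OF w(2) X(2)] X by (simp add: simps cell)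
qed

end

section \<open>Equivalence and replacement\<close>

text \<open>
  Provable and semantic equivalence are carried along together, so that soundness of the whole
  calculus is not required.
\<close>

definition equivalent :: "('p, 'a) fm \<Rightarrow> ('p, 'a) fm \<Rightarrow> bool" (infix "\<simeq>" 50) where
  "\<phi> \<simeq> \<psi> \<longleftrightarrow> \<turnstile> \<phi> \<^bold>\<longleftrightarrow> \<psi> \<and> (\<forall>M :: (('p, 'a) fm set, 'p, 'a) model.
     cond_nbh_model M \<longrightarrow> (\<forall>w \<in> worlds M. (M, w \<Turnstile> \<phi>) \<longleftrightarrow> (M, w \<Turnstile> \<psi>)))"

lemma equivalentI:
  assumes "\<turnstile> \<phi> \<^bold>\<longleftrightarrow> \<psi>"
    and "\<And>(M :: (('p, 'a) fm set, 'p, 'a) model) w.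
      cond_nbh_model M \<Longrightarrow> w \<in> worlds M \<Longrightarrow> (M, w \<Turnstile> \<phi>) \<longleftrightarrow> (M, w \<Turnstile> \<psi>)"
  shows "\<phi> \<simeq> (\<psi> :: ('p, 'a) fm)"
  using assms by (simp add: equivalent_def)

lemma equivalent_prov: "\<phi> \<simeq> \<psi> \<Longrightarrow> \<turnstile> \<phi> \<^bold>\<longleftrightarrow> \<psi>"
  by (simp add: equivalent_def)

lemma equivalent_sat:
  fixes M :: "(('p, 'a) fm set, 'p, 'a) model" and \<phi> :: "('p, 'a) fm"
  shows "\<lbrakk>\<phi> \<simeq> \<psi>; cond_nbh_model M; w \<in> worlds M\<rbrakk> \<Longrightarrow> (M, w \<Turnstile> \<phi>) \<longleftrightarrow> (M, w \<Turnstile> \<psi>)"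
  by (simp add: equivalent_def)

lemma equivalent_refl: "\<phi> \<simeq> \<phi>"
  by (rule equivalentI, rule Taut) (simp_all add: tautology_def)

lemma equivalent_trans [trans]:
  assumes "\<phi> \<simeq> \<psi>" "\<psi> \<simeq> \<chi>"
  shows "\<phi> \<simeq> \<chi>"
  by (rule equivalentI, rule taut_MP2[OF _ equivalent_prov[OF assms(1)] equivalent_prov[OF assms(2)]])
    (auto simp: tautology_def equivalent_sat[OF assms(1)] equivalent_sat[OF assms(2)])

lemma equivalent_Neg:
  assumes "\<phi> \<simeq> \<phi>'"
  shows "\<^bold>\<not> \<phi> \<simeq> \<^bold>\<not> \<phi>'"
  by (rule equivalentI, rule taut_MP[OF _ equivalent_prov[OF assms]])
    (auto simp: tautology_def equivalent_sat[OF assms])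

lemma equivalent_Conj:
  assumes "\<phi> \<simeq> \<phi>'" "\<psi> \<simeq> \<psi>'"
  shows "\<phi> \<^bold>\<and> \<psi> \<simeq> \<phi>' \<^bold>\<and> \<psi>'"
  by (rule equivalentI, rule taut_MP2[OF _ equivalent_prov[OF assms(1)] equivalent_prov[OF assms(2)]])
    (auto simp: tautology_def equivalent_sat[OF assms(1)] equivalent_sat[OF assms(2)])

lemma equivalent_Impl: "\<phi> \<simeq> \<phi>' \<Longrightarrow> \<psi> \<simeq> \<psi>' \<Longrightarrow> (\<phi> \<^bold>\<longrightarrow> \<psi>) \<simeq> (\<phi>' \<^bold>\<longrightarrow> \<psi>')"
  by (intro equivalent_Neg equivalent_Conj)

text \<open>Necessitation turns both equivalences into the premises of \<open>EC\<close> and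
  \<open>M\<close>, which replace the condition and then the belief.\<close>

lemma Bel_mono_prov:
  assumes "\<turnstile> \<phi> \<^bold>\<longleftrightarrow> \<phi>'" "\<turnstile> \<psi> \<^bold>\<longleftrightarrow> \<psi>'"
  shows "\<turnstile> Bel a \<phi> \<psi> \<^bold>\<longrightarrow> Bel a \<phi>' \<psi>'"
proof -
  have "\<turnstile> \<psi> \<^bold>\<longrightarrow> \<psi>'" by (rule taut_MP[OF _ assms(2)]) (simp add: tautology_def)
  then have "\<turnstile> Bel a \<phi>' \<psi> \<^bold>\<longrightarrow> Bel a \<phi>' \<psi>'" by (rule MP[OF M NecK])
  with MP[OF EC NecK[OF assms(1)]] show ?thesis
    by (rule taut_MP2[rotated]) (auto simp: tautology_def)
qed

lemma equivalent_sym: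
  assumes "\<phi> \<simeq> \<psi>"
  shows "\<psi> \<simeq> \<phi>"
  by (rule equivalentI, rule taut_MP[OF _ equivalent_prov[OF assms]])
    (auto simp: tautology_def equivalent_sat[OF assms])

lemma equivalent_Bel:
  fixes \<phi> :: "('p, 'a) fm"
  assumes "\<phi> \<simeq> \<phi>'" "\<psi> \<simeq> \<psi>'"
  shows "Bel a \<phi> \<psi> \<simeq> Bel a \<phi>' \<psi>'"
proof (rule equivalentI)
  have "\<turnstile> Bel a \<phi> \<psi> \<^bold>\<longrightarrow> Bel a \<phi>' \<psi>'" "\<turnstile> Bel a \<phi>' \<psi>' \<^bold>\<longrightarrow> Bel a \<phi> \<psi>"
    using assms by (blast intro: Bel_mono_prov equivalent_prov equivalent_sym)+
  then show "\<turnstile> Bel a \<phi> \<psi> \<^bold>\<longleftrightarrow> Bel a \<phi>' \<psi>'"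
    by (rule taut_MP2[rotated]) (auto simp: tautology_def)
next
  fix M :: "(('p, 'a) fm set, 'p, 'a) model" and w
  assume "cond_nbh_model M"
  then have "{v \<in> worlds M. M, v \<Turnstile> \<phi>} = {v \<in> worlds M. M, v \<Turnstile> \<phi>'}"
    "{v \<in> worlds M. M, v \<Turnstile> \<psi>} = {v \<in> worlds M. M, v \<Turnstile> \<psi>'}"
    using equivalent_sat[OF assms(1)] equivalent_sat[OF assms(2)] by blast+
  then show "(M, w \<Turnstile> Bel a \<phi> \<psi>) \<longleftrightarrow> (M, w \<Turnstile> Bel a \<phi>' \<psi>')" by simp
qed

text \<open>The announced formula stays fixed, as in \<open>RE\<close>. Semantically,
  \<open>w\<close> itself shows that the restriction is nonempty, hence again a model in which the
  equivalence can be used.\<close>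

lemma equivalent_Ann:
  fixes \<phi> :: "('p, 'a) fm"
  assumes "\<psi> \<simeq> \<psi>'"
  shows "\<^bold>[\<phi>\<^bold>] \<psi> \<simeq> \<^bold>[\<phi>\<^bold>] \<psi>'"
proof (rule equivalentI)
  show "\<turnstile> \<^bold>[\<phi>\<^bold>] \<psi> \<^bold>\<longleftrightarrow> \<^bold>[\<phi>\<^bold>] \<psi>'" using RE equivalent_prov[OF assms] .
next
  fix M :: "(('p, 'a) fm set, 'p, 'a) model" and w
  assume M: "cond_nbh_model M" "w \<in> worlds M"
  let ?S = "{v \<in> worlds M. M, v \<Turnstile> \<phi>}"
  have "(restrict_model M ?S, w \<Turnstile> \<psi>) \<longleftrightarrow> (restrict_model M ?S, w \<Turnstile> \<psi>')" if "M, w \<Turnstile> \<phi>"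
  proof (rule equivalent_sat[OF assms])
    show "cond_nbh_model (restrict_model M ?S)"
      by (rule cond_nbh_model.cond_nbh_model_restrict[OF M(1)]) (use M(2) that in auto)
    show "w \<in> worlds (restrict_model M ?S)" using M(2) that by (simp add: restrict_model_def)
  qed
  then show "(M, w \<Turnstile> \<^bold>[\<phi>\<^bold>] \<psi>) \<longleftrightarrow> (M, w \<Turnstile> \<^bold>[\<phi>\<^bold>] \<psi>')" by auto
qed

lemma equivalent_Ann_Bel:
  fixes \<phi> :: "('p, 'a) fm"
  shows "\<^bold>[\<phi>\<^bold>] Bel a \<psi> \<chi> \<simeq> (\<phi> \<^bold>\<longrightarrow> Bel a (\<phi> \<^bold>\<and> \<^bold>[\<phi>\<^bold>] \<psi>) (\<^bold>[\<phi>\<^bold>] \<chi>))"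
proof (rule equivalentI[OF Ann_Bel])
  fix M :: "(('p, 'a) fm set, 'p, 'a) model" and w
  assume "cond_nbh_model M" and w: "w \<in> worlds M"
  then interpret cond_nbh_model M by blast
  let ?S = "{v \<in> worlds M. M, v \<Turnstile> \<phi>}"
  let ?X = "{v \<in> ?S. restrict_model M ?S, v \<Turnstile> \<psi>}"
  have X: "{v \<in> worlds M. M, v \<Turnstile> \<phi> \<^bold>\<and> \<^bold>[\<phi>\<^bold>] \<psi>} = ?X" by auto
  \<comment> \<open>Outside \<open>?S\<close> the announcement formula holds vacuously, but by (c)
    each \<open>Y\<close> lies in \<open>?X\<close> and so in \<open>?S\<close>.\<close>
  have "Y \<subseteq> {v \<in> ?S. restrict_model M ?S, v \<Turnstile> \<chi>} \<longleftrightarrow> Y \<subseteq> {v \<in> worlds M. M, v \<Turnstile> \<^bold>[\<phi>\<^bold>] \<chi>}"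
    if "Y \<in> nbh M a w ?X" for Y
    using c[OF w _ that] by auto
  then have "(\<exists>Y \<in> nbh M a w ?X. Y \<subseteq> {v \<in> ?S. restrict_model M ?S, v \<Turnstile> \<chi>})
    \<longleftrightarrow> (\<exists>Y \<in> nbh M a w ?X. Y \<subseteq> {v \<in> worlds M. M, v \<Turnstile> \<^bold>[\<phi>\<^bold>] \<chi>})"
    by (rule bex_cong[OF refl])
  moreover have "(restrict_model M ?S, w \<Turnstile> Bel a \<psi> \<chi>)
    \<longleftrightarrow> (\<exists>Y \<in> nbh M a w ?X. Y \<subseteq> {v \<in> ?S. restrict_model M ?S, v \<Turnstile> \<chi>})"
    by (simp add: restrict_model_def)
  moreover have "(M, w \<Turnstile> Bel a (\<phi> \<^bold>\<and> \<^bold>[\<phi>\<^bold>] \<psi>) (\<^bold>[\<phi>\<^bold>] \<chi>))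
    \<longleftrightarrow> (\<exists>Y \<in> nbh M a w ?X. Y \<subseteq> {v \<in> worlds M. M, v \<Turnstile> \<^bold>[\<phi>\<^bold>] \<chi>})"
    by (simp only: sat.simps(5) X)
  ultimately show "(M, w \<Turnstile> \<^bold>[\<phi>\<^bold>] Bel a \<psi> \<chi>) \<longleftrightarrow>
      (M, w \<Turnstile> \<phi> \<^bold>\<longrightarrow> Bel a (\<phi> \<^bold>\<and> \<^bold>[\<phi>\<^bold>] \<psi>) (\<^bold>[\<phi>\<^bold>] \<chi>))"
    by (simp only: sat.simps(3,4,6)) blast
qed

section \<open>Reduction to announcement-free formulas\<close>

text \<open>The reduction axioms push the announcement of \<open>\<phi>\<close> inwards until it
  disappears. Each copy of \<open>\<phi>\<close> that surfaces outside the brackets is replaced by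
  \<open>\<phi>'\<close>, so no replacement inside the brackets occurs.\<close>

lemma static_Ann:
  assumes "\<phi> \<simeq> \<phi>'" "static \<phi>'"
  shows "static \<psi> \<Longrightarrow> \<exists>\<theta>. static \<theta> \<and> \<^bold>[\<phi>\<^bold>] \<psi> \<simeq> \<theta>"
proof (induction \<psi>)
  case Truth
  have "\<^bold>[\<phi>\<^bold>] \<^bold>\<top> \<simeq> \<^bold>\<top>" by (rule equivalentI[OF Ann_Truth]) simp
  then show ?case using static.simps(1) by blast
next
  case (Prop p)
  have "\<^bold>[\<phi>\<^bold>] Prop p \<simeq> (\<phi> \<^bold>\<longrightarrow> Prop p)"
    by (rule equivalentI[OF Ann_Prop]) (auto simp: restrict_model_def)
  also have "\<dots> \<simeq> (\<phi>' \<^bold>\<longrightarrow> Prop p)" by (intro equivalent_Impl assms equivalent_refl)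
  finally show ?case using assms(2) by (intro exI[of _ "\<phi>' \<^bold>\<longrightarrow> Prop p"]) simp
next
  case (Neg \<psi>)
  then obtain \<theta> where \<theta>: "static \<theta>" "\<^bold>[\<phi>\<^bold>] \<psi> \<simeq> \<theta>" by auto
  have "\<^bold>[\<phi>\<^bold>] \<^bold>\<not> \<psi> \<simeq> (\<phi> \<^bold>\<longrightarrow> \<^bold>\<not> \<^bold>[\<phi>\<^bold>] \<psi>)" by (rule equivalentI[OF Ann_Neg]) auto
  also have "\<dots> \<simeq> (\<phi>' \<^bold>\<longrightarrow> \<^bold>\<not> \<theta>)" by (intro equivalent_Impl equivalent_Neg assms \<theta>)
  finally show ?case using assms(2) \<theta>(1) by (intro exI[of _ "\<phi>' \<^bold>\<longrightarrow> \<^bold>\<not> \<theta>"]) simp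
next
  case (Conj \<psi> \<chi>)
  then obtain \<theta> \<eta> where \<theta>: "static \<theta>" "\<^bold>[\<phi>\<^bold>] \<psi> \<simeq> \<theta>" "static \<eta>" "\<^bold>[\<phi>\<^bold>] \<chi> \<simeq> \<eta>" by auto
  have "\<^bold>[\<phi>\<^bold>] (\<psi> \<^bold>\<and> \<chi>) \<simeq> (\<^bold>[\<phi>\<^bold>] \<psi> \<^bold>\<and> \<^bold>[\<phi>\<^bold>] \<chi>)" by (rule equivalentI[OF Ann_Conj]) auto
  also have "\<dots> \<simeq> \<theta> \<^bold>\<and> \<eta>" by (intro equivalent_Conj \<theta>)
  finally show ?case using \<theta> by (intro exI[of _ "\<theta> \<^bold>\<and> \<eta>"]) simp
next
  case (Bel a \<psi> \<chi>)
  then obtain \<theta> \<eta> where \<theta>: "static \<theta>" "\<^bold>[\<phi>\<^bold>] \<psi> \<simeq> \<theta>" "static \<eta>" "\<^bold>[\<phi>\<^bold>] \<chi> \<simeq> \<eta>" by auto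
  note equivalent_Ann_Bel
  also have "(\<phi> \<^bold>\<longrightarrow> Bel a (\<phi> \<^bold>\<and> \<^bold>[\<phi>\<^bold>] \<psi>) (\<^bold>[\<phi>\<^bold>] \<chi>)) \<simeq> (\<phi>' \<^bold>\<longrightarrow> Bel a (\<phi>' \<^bold>\<and> \<theta>) \<eta>)"
    by (intro equivalent_Impl equivalent_Bel equivalent_Conj assms \<theta>)
  finally show ?case using assms(2) \<theta> by (intro exI[of _ "\<phi>' \<^bold>\<longrightarrow> Bel a (\<phi>' \<^bold>\<and> \<theta>) \<eta>"]) simp
qed simp

lemma static_equivalent: "\<exists>\<theta>. static \<theta> \<and> \<phi> \<simeq> \<theta>"
proof (induction \<phi>)
  case Truth
  show ?case by (rule exI[of _ "\<^bold>\<top>"]) (simp add: equivalent_refl)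
next
  case (Prop p)
  show ?case by (rule exI[of _ "Prop p"]) (simp add: equivalent_refl)
next
  case (Neg \<phi>)
  then obtain \<theta> where "static \<theta>" "\<phi> \<simeq> \<theta>" by blast
  then show ?case by (intro exI[of _ "\<^bold>\<not> \<theta>"]) (simp add: equivalent_Neg)
next
  case (Conj \<phi> \<psi>)
  then obtain \<theta> \<eta> where "static \<theta>" "\<phi> \<simeq> \<theta>" "static \<eta>" "\<psi> \<simeq> \<eta>" by blast
  then show ?case by (intro exI[of _ "\<theta> \<^bold>\<and> \<eta>"]) (simp add: equivalent_Conj)
next
  case (Bel a \<phi> \<psi>)
  then obtain \<theta> \<eta> where "static \<theta>" "\<phi> \<simeq> \<theta>" "static \<eta>" "\<psi> \<simeq> \<eta>" by blast
  then show ?case by (intro exI[of _ "Bel a \<theta> \<eta>"]) (simp add: equivalent_Bel)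
next
  case (Ann \<phi> \<psi>)
  then obtain \<theta> \<eta> where "static \<theta>" "\<phi> \<simeq> \<theta>" "static \<eta>" "\<psi> \<simeq> \<eta>" by blast
  \<comment> \<open>Innermost first: \<open>\<psi>\<close> is replaced by \<open>\<eta>\<close>
    within the scope of the announcement, after which the outer announcement can be
    eliminated.\<close>
  moreover from this obtain \<xi> where "static \<xi>" "\<^bold>[\<phi>\<^bold>] \<eta> \<simeq> \<xi>" using static_Ann by blast
  ultimately show ?case using equivalent_trans[OF equivalent_Ann] by blast
qed

theorem theorem7:
  fixes \<phi> :: "('p, 'a::finite) fm"
  assumes "valid \<phi>"
  shows "\<turnstile> \<phi>"
proof -
  obtain \<theta> where \<theta>: "static \<theta>" "\<phi> \<simeq> \<theta>" using static_equivalent by blast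
  have "\<turnstile> \<theta>"
  proof (rule ccontr)
    assume "\<not> \<turnstile> \<theta>"
    then obtain w where w: "mcs w" "\<^bold>\<not> \<theta> \<in> w"
      using consistent_insert_neg[of "{}" \<theta>] lindenbaum deriv_empty by blast
    then have "\<not> (canonical, w \<Turnstile> \<theta>)" using truth_lemma[OF \<theta>(1)] by auto
    \<comment> \<open>Validity is used for the original \<open>\<phi>\<close>; the equivalence
      carries it to \<open>\<theta>\<close>, to which the truth lemma applies.\<close>
    moreover have "canonical, w \<Turnstile> \<phi>"
      using assms cond_nbh_model_canonical[OF w(1)] w(1) by (auto simp: valid_def worlds_canonical)
    ultimately show False
      using equivalent_sat[OF \<theta>(2) cond_nbh_model_canonical[OF w(1)]] w(1)
      by (simp add: worlds_canonical)
  qed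
  with equivalent_prov[OF \<theta>(2)] show ?thesis
    by (rule taut_MP2[rotated]) (simp add: tautology_def)
qed

end
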